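(* Let $M$ be a proper equicardinal set system over $V$. Then the following are equivalent: (i) $P_M(y)=0$; (ii) the degree of $P_M(y)$ is smaller than $d_{M*V}$; (iii) $M+X=M$ for some $X\subseteq V$ with $|X|$ odd.
   Context: A set system $M=(V,D)$ is proper if $D\neq\emptyset$ and equicardinal if all members of $D$ have the same cardinality. Twist $M*X=(V,\{Y\triangle X:Y\in D\})$; loop complementation $M+X=(V,D')$ with $Y\in D'$ iff the number of $W\in D$ with $Y\setminus X\subseteq W\subseteq Y$ is odd; dual pivot $M\bar{*}X=(V,D'')$ with $Y\in D''$ iff the number of $W\in D$ with $Y\subseteq W\subseteq Y\cup X$ is odd; operations are applied left to right. $d_M=\min\{|Y|:Y\in D\}$ (taken to be $+\infty$... not needed if nonempty). The Penrose polynomial is $P_M(y)=\sum_{X\subseteq V}(-1)^{|X|}y^{d_{M*V\bar{*}X}}$, where a term whose set system $M*V\bar*X$ has empty family contributes nothing. The zero polynomial is regarded as having degree smaller than any integer. *)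

theory Defs
  imports "HOL-Computational_Algebra.Polynomial"
begin

text \<open>A set system \<open>(V, D)\<close>: a finite ground set with a family of subsets of it.\<close>

type_synonym 'a set_system = "'a set \<times> 'a set set"

definition set_system :: "'a set_system \<Rightarrow> bool" where
  "set_system M \<longleftrightarrow> finite (fst M) \<and> snd M \<subseteq> Pow (fst M)"

definition proper :: "'a set_system \<Rightarrow> bool" where
  "proper M \<longleftrightarrow> snd M \<noteq> {}"

definition equicardinal :: "'a set_system \<Rightarrow> bool" where
  "equicardinal M \<longleftrightarrow> (\<forall>Y\<in>snd M. \<forall>Z\<in>snd M. card Y = card Z)"

definition twist :: "'a set_system \<Rightarrow> 'a set \<Rightarrow> 'a set_system" where
  "twist M X = (fst M, (\<lambda>Y. (Y - X) \<union> (X - Y)) ` snd M)"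

definition loop_compl :: "'a set_system \<Rightarrow> 'a set \<Rightarrow> 'a set_system" where
  "loop_compl M X =
     (fst M, {Y. Y \<subseteq> fst M \<and> odd (card {W \<in> snd M. Y - X \<subseteq> W \<and> W \<subseteq> Y})})"

definition dual_pivot :: "'a set_system \<Rightarrow> 'a set \<Rightarrow> 'a set_system" where
  "dual_pivot M X =
     (fst M, {Y. Y \<subseteq> fst M \<and> odd (card {W \<in> snd M. Y \<subseteq> W \<and> W \<subseteq> Y \<union> X})})"

text \<open>Only meaningful for proper set systems, since \<^const>\<open>Min\<close> is unspecified on the empty set.\<close>

definition min_card :: "'a set_system \<Rightarrow> nat" where
  "min_card M = Min (card ` snd M)"

definition penrose_poly :: "'a set_system \<Rightarrow> int poly" where
  "penrose_poly M =
     (\<Sum>X\<in>Pow (fst M).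
        let N = dual_pivot (twist M (fst M)) X
        in if proper N then monom ((- 1) ^ card X) (min_card N) else 0)"

text \<open>The library sets \<^prop>\<open>degree 0 = 0\<close>; here the zero polynomial has degree below every integer.\<close>

definition degree_less :: "'b::zero poly \<Rightarrow> nat \<Rightarrow> bool" where
  "degree_less p n \<longleftrightarrow> p = 0 \<or> degree p < n"

end

theory Submission
  imports Defs
begin

text \<open>
  Let \<open>N = M * V\<close>, an equicardinal system with members of size \<open>r\<close>. Dual pivots compose by
  symmetric difference of their arguments, so the sets \<open>X\<close> fixing \<open>N\<close> form a group under
  symmetric difference, and they are exactly the sets fixing \<open>M\<close> under loop complementation.
  Every member of \<open>N\<close> survives in the dual pivot of \<open>N\<close> on \<open>X\<close>, and all other members there are
  smaller; hence only the stabilizer contributes to the coefficient of \<open>y^r\<close>. If the stabilizer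
  has no odd element, that coefficient is its cardinality, which is positive. If \<open>X\<^sub>0\<close> is an odd
  element, taking symmetric difference with \<open>X\<^sub>0\<close> cancels the whole Penrose polynomial in pairs.
\<close>

section \<open>Parity of set intervals and sign-reversing involutions\<close>

lemma card_set_interval:
  assumes "finite B" "A \<subseteq> B"
  shows "card {C. A \<subseteq> C \<and> C \<subseteq> B} = 2 ^ card (B - A)"
proof -
  have "bij_betw (\<lambda>C. C - A) {C. A \<subseteq> C \<and> C \<subseteq> B} (Pow (B - A))"
    by (rule bij_betw_byWitness[where f' = "\<lambda>C. C \<union> A"]) (use assms in auto)
  then show ?thesis
    using assms by (simp add: bij_betw_same_card card_Pow)
qed

text \<open>The interval is empty unless \<open>A\<close> lies in \<open>B\<close>, and otherwise
  its size is a power of two, which is odd only for exponent zero.\<close>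

lemma odd_card_set_interval_iff:
  assumes "finite B"
  shows "odd (card {C. A \<subseteq> C \<and> C \<subseteq> B}) \<longleftrightarrow> A = B"
proof (cases "A \<subseteq> B")
  case True
  have "card (B - A) = 0 \<longleftrightarrow> B - A = {}"
    using assms by simp
  then show ?thesis
    using True card_set_interval[OF assms True] by auto
next
  case False
  then have "{C. A \<subseteq> C \<and> C \<subseteq> B} = {}"
    by auto
  then show ?thesis
    by (simp only: card.empty) (use False in auto)
qed

lemma even_card_sym_diff_iff:
  assumes "finite A" "finite B"
  shows "even (card (sym_diff A B)) \<longleftrightarrow> (even (card A) \<longleftrightarrow> even (card B))"
proof -
  have "card (sym_diff A B) = card (A - B) + card (B - A)"
    using assms by (intro card_Un_disjoint) auto
  moreover have "card A = card (A - B) + card (A \<inter> B)"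
    using assms by (subst card_Un_disjoint[symmetric]) (auto intro!: arg_cong[where f = card])
  moreover have "card B = card (B - A) + card (A \<inter> B)"
    using assms by (subst card_Un_disjoint[symmetric]) (auto intro!: arg_cong[where f = card])
  ultimately show ?thesis
    by auto
qed

text \<open>Reindexing along the involution \<open>sym_diff X0\<close> shows that the sum is its own
  negative; the type classes allow cancelling the factor 2.\<close>

lemma sum_Pow_eq_0_if_sym_diff_negates:
  fixes f :: "'a set \<Rightarrow> 'b::{ab_group_add, semiring_no_zero_divisors, semiring_char_0}"
  assumes "finite V" "X0 \<subseteq> V"
    and neg: "\<And>X. X \<subseteq> V \<Longrightarrow> f (sym_diff X0 X) = - f X"
  shows "sum f (Pow V) = 0"
proof -
  have "bij_betw (sym_diff X0) (Pow V) (Pow V)"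
    by (rule bij_betw_byWitness[where f' = "sym_diff X0"]) (use assms in auto)
  then have "sum f (Pow V) = (\<Sum>X\<in>Pow V. f (sym_diff X0 X))"
    by (rule sum.reindex_bij_betw[symmetric])
  also have "\<dots> = - sum f (Pow V)"
    by (simp add: neg sum_negf)
  finally have "2 * sum f (Pow V) = 0"
    by (simp add: mult_2 eq_neg_iff_add_eq_0)
  then show ?thesis
    by simp
qed

section \<open>Complementation as a duality between loop complementation and dual pivot\<close>

text \<open>On subsets of the ground set, symmetric difference with it is complementation. The
  comprehension matches the shape of \<open>loop_compl\<close> and \<open>dual_pivot\<close>, so
  families can be compared member by member.\<close>

lemma twist_ground_set:
  assumes "set_system M"
  shows "twist M (fst M) = (fst M, {Y. Y \<subseteq> fst M \<and> fst M - Y \<in> snd M})"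
proof -
  have "(Y - fst M) \<union> (fst M - Y) = fst M - Y" if "Y \<in> snd M" for Y
    using that assms by (auto simp: set_system_def)
  then have "(\<lambda>Y. (Y - fst M) \<union> (fst M - Y)) ` snd M = (\<lambda>Y. fst M - Y) ` snd M"
    by (intro image_cong) auto
  also have "\<dots> = {Y. Y \<subseteq> fst M \<and> fst M - Y \<in> snd M}"
  proof (intro equalityI subsetI)
    fix Y assume "Y \<in> (\<lambda>Y. fst M - Y) ` snd M"
    then show "Y \<in> {Y. Y \<subseteq> fst M \<and> fst M - Y \<in> snd M}"
      using assms by (auto simp: set_system_def double_diff)
  next
    fix Y assume "Y \<in> {Y. Y \<subseteq> fst M \<and> fst M - Y \<in> snd M}"
    then show "Y \<in> (\<lambda>Y. fst M - Y) ` snd M"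
      by (intro image_eqI[where x = "fst M - Y"]) auto
  qed
  finally show ?thesis
    by (simp add: twist_def)
qed

lemma set_system_twist_ground_set: "set_system M \<Longrightarrow> set_system (twist M (fst M))"
  by (auto simp: twist_ground_set) (auto simp: set_system_def)

lemma proper_twist: "proper (twist M X) \<longleftrightarrow> proper M"
  by (simp add: proper_def twist_def)

lemma equicardinal_twist_ground_set:
  assumes "set_system M" "equicardinal M"
  shows "equicardinal (twist M (fst M))"
  unfolding equicardinal_def
proof (intro ballI)
  fix Y Z assume "Y \<in> snd (twist M (fst M))" "Z \<in> snd (twist M (fst M))"
  then have YZ: "Y \<subseteq> fst M" "Z \<subseteq> fst M" "fst M - Y \<in> snd M" "fst M - Z \<in> snd M"
    by (auto simp: twist_ground_set[OF assms(1)])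
  have fin: "finite (fst M)"
    using assms(1) by (simp add: set_system_def)
  have "card (fst M - Y) = card (fst M - Z)"
    using YZ assms(2) unfolding equicardinal_def by blast
  then show "card Y = card Z"
    using YZ fin by (metis card_Diff_subset card_mono diff_diff_cancel finite_subset)
qed

lemma set_system_loop_compl: "set_system M \<Longrightarrow> set_system (loop_compl M X)"
  by (auto simp: set_system_def loop_compl_def)

text \<open>Complementation reverses inclusion: it carries the members of \<open>M\<close> between
  \<open>fst M - Y - X\<close> and \<open>fst M - Y\<close> bijectively to the members of the twist
  between \<open>Y\<close> and \<open>Y \<union> X\<close>, so both parity conditions count the same
  number.\<close>

lemma twist_loop_compl:
  assumes "set_system M"
  shows "twist (loop_compl M X) (fst M) = dual_pivot (twist M (fst M)) X"
proof -
  have "card {W \<in> snd M. fst M - Y - X \<subseteq> W \<and> W \<subseteq> fst M - Y} =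
        card {W \<in> {W. W \<subseteq> fst M \<and> fst M - W \<in> snd M}. Y \<subseteq> W \<and> W \<subseteq> Y \<union> X}"
    if "Y \<subseteq> fst M" for Y
  proof (rule bij_betw_same_card[of "\<lambda>W. fst M - W"],
      rule bij_betw_byWitness[where f' = "\<lambda>W. fst M - W"])
    show "(\<lambda>W. fst M - W) ` {W \<in> snd M. fst M - Y - X \<subseteq> W \<and> W \<subseteq> fst M - Y} \<subseteq>
      {W \<in> {W. W \<subseteq> fst M \<and> fst M - W \<in> snd M}. Y \<subseteq> W \<and> W \<subseteq> Y \<union> X}"
      using assms that by (auto simp: set_system_def double_diff)
  qed (use assms in \<open>auto simp: set_system_def\<close>)
  then show ?thesis
    using twist_ground_set[OF set_system_loop_compl[OF assms], of X]
    by (simp add: twist_ground_set[OF assms] loop_compl_def dual_pivot_def cong: conj_cong)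
qed

lemma twist_ground_set_eq_iff:
  assumes "set_system M" "set_system N" "fst M = fst N"
  shows "twist M (fst M) = twist N (fst N) \<longleftrightarrow> M = N"
proof
  have involution: "twist (twist K (fst K)) (fst K) = K" if "set_system K" for K :: "'a set_system"
    using that twist_ground_set[OF set_system_twist_ground_set[OF that]]
    by (auto simp: twist_ground_set[OF that] set_system_def double_diff prod_eq_iff)
  assume "twist M (fst M) = twist N (fst N)"
  then show "M = N"
    using involution assms by metis
qed simp

text \<open>Twisting by the ground set is injective and turns loop complementation into dual pivot,
  so fixed points correspond.\<close>

lemma loop_compl_eq_iff_dual_pivot_twist_eq:
  assumes "set_system M"
  shows "loop_compl M X = M \<longleftrightarrow> dual_pivot (twist M (fst M)) X = twist M (fst M)"
  using twist_ground_set_eq_iff[OF set_system_loop_compl[OF assms] assms] twist_loop_compl[OF assms]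
  by (simp add: loop_compl_def)

section \<open>Composition of dual pivots\<close>

text \<open>Counting the chains \<open>Y \<subseteq> U \<subseteq> W\<close> through the first pivot by their top \<open>W\<close>: the admissible
  \<open>U\<close> form an interval, whose size is odd only if its end points coincide.\<close>

lemma dual_pivot_dual_pivot:
  assumes "set_system N"
  shows "dual_pivot (dual_pivot N X) Z = dual_pivot N (sym_diff X Z)"
proof -
  have finV: "finite (fst N)" and sub: "snd N \<subseteq> Pow (fst N)"
    using assms by (auto simp: set_system_def)
  have finD: "finite (snd N)"
    using finV sub by (meson finite_Pow_iff finite_subset)
  have "odd (card {U \<in> {Y. Y \<subseteq> fst N \<and> odd (card {W \<in> snd N. Y \<subseteq> W \<and> W \<subseteq> Y \<union> X})}.
            Y \<subseteq> U \<and> U \<subseteq> Y \<union> Z})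
      \<longleftrightarrow> odd (card {W \<in> snd N. Y \<subseteq> W \<and> W \<subseteq> Y \<union> sym_diff X Z})" (is "?L \<longleftrightarrow> ?R")
    if "Y \<subseteq> fst N" for Y
  proof -
    define A where "A = {U. U \<subseteq> fst N \<and> Y \<subseteq> U \<and> U \<subseteq> Y \<union> Z}"
    have finA: "finite A"
      using finV by (auto simp: A_def)
    have "{U \<in> {Y. Y \<subseteq> fst N \<and> odd (card {W \<in> snd N. Y \<subseteq> W \<and> W \<subseteq> Y \<union> X})}.
            Y \<subseteq> U \<and> U \<subseteq> Y \<union> Z} =
          {U \<in> A. odd (card {W \<in> snd N. U \<subseteq> W \<and> W \<subseteq> U \<union> X})}"
      by (auto simp: A_def)
    \<comment> \<open>A sum of naturals has the parity of the number of its odd summands; the same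
      fact is used again after exchanging the summations.\<close>
    then have "?L \<longleftrightarrow> odd (\<Sum>U\<in>A. card {W \<in> snd N. U \<subseteq> W \<and> W \<subseteq> U \<union> X})"
      using finA by (simp add: even_sum_iff)
    also have "(\<Sum>U\<in>A. card {W \<in> snd N. U \<subseteq> W \<and> W \<subseteq> U \<union> X}) =
               (\<Sum>W\<in>snd N. card {U \<in> A. U \<subseteq> W \<and> W \<subseteq> U \<union> X})"
      using finA finD sum.swap_restrict[of A "snd N" "\<lambda>_ _. 1::nat" "\<lambda>U W. U \<subseteq> W \<and> W \<subseteq> U \<union> X"]
      by simp
    also have "odd \<dots> \<longleftrightarrow> odd (card {W \<in> snd N. odd (card {U \<in> A. U \<subseteq> W \<and> W \<subseteq> U \<union> X})})"
      using finD by (simp add: even_sum_iff)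
    also have "{W \<in> snd N. odd (card {U \<in> A. U \<subseteq> W \<and> W \<subseteq> U \<union> X})} =
               {W \<in> snd N. Y \<subseteq> W \<and> W \<subseteq> Y \<union> sym_diff X Z}"
    proof (intro Collect_cong conj_cong refl)
      fix W assume W: "W \<in> snd N"
      then have WV: "W \<subseteq> fst N"
        using sub by auto
      show "odd (card {U \<in> A. U \<subseteq> W \<and> W \<subseteq> U \<union> X}) \<longleftrightarrow> Y \<subseteq> W \<and> W \<subseteq> Y \<union> sym_diff X Z"
      proof (cases "Y \<subseteq> W")
        case True
        \<comment> \<open>The lower bound arises because \<open>W \<subseteq> U \<union> X\<close>
          means \<open>W - X \<subseteq> U\<close>.\<close>
        have "{U \<in> A. U \<subseteq> W \<and> W \<subseteq> U \<union> X} = {U. (W - X) \<union> Y \<subseteq> U \<and> U \<subseteq> W \<inter> (Y \<union> Z)}"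
          using WV by (auto simp: A_def)
        moreover have "finite (W \<inter> (Y \<union> Z))"
          using WV finV finite_subset by blast
        ultimately have "odd (card {U \<in> A. U \<subseteq> W \<and> W \<subseteq> U \<union> X}) \<longleftrightarrow>
            (W - X) \<union> Y = W \<inter> (Y \<union> Z)"
          by (simp only: odd_card_set_interval_iff)
        \<comment> \<open>Points of \<open>Y\<close> lie on both sides. A point of
          \<open>W - Y\<close> lies on the left iff it avoids \<open>X\<close> and on the right iff
          it is in \<open>Z\<close>, so equality asks for membership in exactly one of
          \<open>X\<close> and \<open>Z\<close>.\<close>
        also have "\<dots> \<longleftrightarrow> Y \<subseteq> W \<and> W \<subseteq> Y \<union> sym_diff X Z"
          using True by blast
        finally show ?thesis .
      next
        case False
        then have "{U \<in> A. U \<subseteq> W \<and> W \<subseteq> U \<union> X} = {}"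
          by (auto simp: A_def)
        then show ?thesis
          using False by (simp only: card.empty) simp
      qed
    qed
    finally show ?thesis .
  qed
  then show ?thesis
    by (simp add: dual_pivot_def cong: conj_cong)
qed

lemma dual_pivot_empty:
  assumes "set_system N"
  shows "dual_pivot N {} = N"
proof -
  have "{W \<in> snd N. Y \<subseteq> W \<and> W \<subseteq> Y \<union> {}} = (if Y \<in> snd N then {Y} else {})" for Y
    by auto
  then show ?thesis
    using assms by (auto simp: dual_pivot_def set_system_def prod_eq_iff split: if_splits)
qed

text \<open>Members of equal finite size form an antichain, so a member \<open>Y\<close> counts only
  itself, and one is odd.\<close>

lemma subset_dual_pivot:
  assumes "set_system N" "equicardinal N"
  shows "snd N \<subseteq> snd (dual_pivot N X)"
proof
  fix Y assume Y: "Y \<in> snd N"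
  have "W = Y" if "W \<in> snd N" "Y \<subseteq> W" for W
    using that Y assms by (metis PowD card_subset_eq equicardinal_def finite_subset set_system_def subsetD)
  then have "{W \<in> snd N. Y \<subseteq> W \<and> W \<subseteq> Y \<union> X} = {Y}"
    using Y by auto
  then have "card {W \<in> snd N. Y \<subseteq> W \<and> W \<subseteq> Y \<union> X} = 1"
    by simp
  then show "Y \<in> snd (dual_pivot N X)"
    using Y assms by (auto simp: dual_pivot_def set_system_def)
qed

section \<open>Minimum sizes and the coefficients of the Penrose polynomial\<close>

lemma min_card_equicardinal:
  assumes "equicardinal N" "Y \<in> snd N"
  shows "min_card N = card Y"
proof -
  have "card ` snd N = {card Y}"
    using assms unfolding equicardinal_def by blast
  then show ?thesis
    by (simp add: min_card_def)
qed

lemma dual_pivot_eq_iff_min_card_eq: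
  assumes "set_system N" "proper N" "equicardinal N"
  shows "min_card (dual_pivot N X) = min_card N \<longleftrightarrow> dual_pivot N X = N"
proof
  assume eq: "min_card (dual_pivot N X) = min_card N"
  have "snd (dual_pivot N X) \<subseteq> snd N"
  proof
    fix Z assume Z: "Z \<in> snd (dual_pivot N X)"
    \<comment> \<open>An odd count is nonzero, so \<open>Z\<close> lies below some member
      \<open>W\<close> of \<open>N\<close>. The assumed minimum makes \<open>Z\<close> at least as
      large as \<open>W\<close>, forcing equality.\<close>
    then have "card {W \<in> snd N. Z \<subseteq> W \<and> W \<subseteq> Z \<union> X} \<noteq> 0"
      by (auto simp: dual_pivot_def intro: ccontr)
    then obtain W where W: "W \<in> snd N" "Z \<subseteq> W"
      by (metis (no_types, lifting) card.empty empty_Collect_eq)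
    have "finite (snd (dual_pivot N X))"
      using assms by (auto simp: dual_pivot_def set_system_def)
    then have "min_card (dual_pivot N X) \<le> card Z"
      using Z by (simp add: min_card_def)
    then have "card W \<le> card Z"
      using eq min_card_equicardinal[OF assms(3) W(1)] by simp
    moreover have "finite W"
      using W assms by (auto simp: set_system_def intro: finite_subset)
    ultimately show "Z \<in> snd N"
      using W card_seteq by metis
  qed
  then show "dual_pivot N X = N"
    using subset_dual_pivot[OF assms(1,3), of X]
    by (simp add: prod_eq_iff) (simp add: dual_pivot_def)
qed simp

text \<open>Replacing \<open>X\<close> by \<open>sym_diff X0 X\<close> preserves the pivoted system,
  hence the exponent, while the odd size of \<open>X0\<close> flips the sign.\<close>

lemma penrose_poly_eq_0:
  assumes "set_system M" "X0 \<subseteq> fst M" "odd (card X0)"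
    and fixed: "dual_pivot (twist M (fst M)) X0 = twist M (fst M)"
  shows "penrose_poly M = 0"
  unfolding penrose_poly_def
proof (rule sum_Pow_eq_0_if_sym_diff_negates)
  show fin: "finite (fst M)"
    using assms by (simp add: set_system_def)
  fix X assume "X \<subseteq> fst M"
  then have "even (card (sym_diff X0 X)) \<longleftrightarrow> odd (card X)"
    using even_card_sym_diff_iff[of X0 X] assms fin finite_subset by blast
  then have "(- 1) ^ card (sym_diff X0 X) = - ((- 1) ^ card X :: int)"
    by (cases "even (card X)") auto
  moreover have "dual_pivot (twist M (fst M)) (sym_diff X0 X) = dual_pivot (twist M (fst M)) X"
    using dual_pivot_dual_pivot[OF set_system_twist_ground_set[OF assms(1)], of X0 X] fixed by simp
  ultimately show "(let N = dual_pivot (twist M (fst M)) (sym_diff X0 X)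
        in if proper N then monom ((- 1) ^ card (sym_diff X0 X)) (min_card N) else 0) =
      - (let N = dual_pivot (twist M (fst M)) X
        in if proper N then monom ((- 1) ^ card X) (min_card N) else (0 :: int poly))"
    by (simp add: Let_def minus_monom)
qed (use assms in simp)

lemma coeff_penrose_poly_min_card:
  assumes "set_system M" "proper M" "equicardinal M"
  shows "coeff (penrose_poly M) (min_card (twist M (fst M))) =
    (\<Sum>X | X \<subseteq> fst M \<and> dual_pivot (twist M (fst M)) X = twist M (fst M). (- 1) ^ card X)"
proof -
  define N where "N = twist M (fst M)"
  have N: "set_system N" "proper N" "equicardinal N"
    using assms by (simp_all add: N_def set_system_twist_ground_set proper_twist
        equicardinal_twist_ground_set)
  \<comment> \<open>Every dual pivot contains the nonempty family of \<open>N\<close>, so the zero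
    branch in \<open>penrose_poly\<close> never occurs.\<close>
  have proper: "proper (dual_pivot N X)" for X
    using subset_dual_pivot[OF N(1,3), of X] N(2) by (auto simp: proper_def)
  have "coeff (penrose_poly M) (min_card N) =
      (\<Sum>X\<in>Pow (fst M). if dual_pivot N X = N then (- 1) ^ card X else 0)"
    by (simp add: penrose_poly_def coeff_sum N_def[symmetric] proper
        dual_pivot_eq_iff_min_card_eq[OF N])
  also have "\<dots> = (\<Sum>X | X \<subseteq> fst M \<and> dual_pivot N X = N. (- 1) ^ card X)"
    using assms(1) by (simp add: set_system_def sum.inter_filter[symmetric])
  finally show ?thesis
    by (simp add: N_def)
qed

theorem theorem6:
  fixes V :: "'a set" and D :: "'a set set" and M :: "'a set_system"
  assumes "M = (V, D)" and "set_system M" and "proper M" and "equicardinal M"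
  shows "(penrose_poly M = 0 \<longleftrightarrow> degree_less (penrose_poly M) (min_card (twist M V)))
       \<and> (degree_less (penrose_poly M) (min_card (twist M V))
            \<longleftrightarrow> (\<exists>X. X \<subseteq> V \<and> odd (card X) \<and> loop_compl M X = M))"
proof -
  have V: "V = fst M"
    using assms(1) by simp
  let ?S = "{X. X \<subseteq> V \<and> dual_pivot (twist M V) X = twist M V}"
  have "\<exists>X. X \<subseteq> V \<and> odd (card X) \<and> loop_compl M X = M"
    if "degree_less (penrose_poly M) (min_card (twist M V))"
  proof (rule ccontr)
    assume "\<nexists>X. X \<subseteq> V \<and> odd (card X) \<and> loop_compl M X = M"
    then have "even (card X)" if "X \<in> ?S" for X
      using that loop_compl_eq_iff_dual_pivot_twist_eq[OF assms(2), of X] V by auto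
    then have "(\<Sum>X\<in>?S. (- 1) ^ card X) = int (card ?S)"
      by simp
    \<comment> \<open>The empty set makes the stabilizer nonempty, hence its cardinality
      positive.\<close>
    moreover have "{} \<in> ?S"
      using V assms(2) by (simp add: dual_pivot_empty set_system_twist_ground_set)
    moreover have "finite ?S"
      using V assms(2) by (simp add: set_system_def)
    ultimately have "(\<Sum>X\<in>?S. (- 1) ^ card X) \<noteq> (0::int)"
      by (metis card_0_eq empty_iff of_nat_eq_0_iff)
    then have "coeff (penrose_poly M) (min_card (twist M V)) \<noteq> 0"
      using coeff_penrose_poly_min_card[OF assms(2-4)] V by simp
    \<comment> \<open>A nonzero coefficient excludes the zero polynomial and bounds the degree from
      below, which refutes both cases of \<open>degree_less\<close>.\<close>
    then show False
      using that le_degree by (fastforce simp: degree_less_def)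
  qed
  moreover have "penrose_poly M = 0"
    if "\<exists>X. X \<subseteq> V \<and> odd (card X) \<and> loop_compl M X = M"
    using that penrose_poly_eq_0[OF assms(2)] loop_compl_eq_iff_dual_pivot_twist_eq[OF assms(2)] V
    by auto
  moreover have "degree_less (penrose_poly M) (min_card (twist M V))" if "penrose_poly M = 0"
    using that by (simp add: degree_less_def)
  ultimately show ?thesis
    by blast
qed

end
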